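(* Let $(\mathfrak g,[\cdot,\cdot]_{\mathfrak g})$ be a Lie algebra over $\mathbb K$ and $\alpha\in\mathrm{Aut}(\mathfrak g)$. Then the endomorphism $\Omega:=\alpha+{}^t\alpha$ of $T^*(\mathfrak g)=\mathfrak g\oplus\mathfrak g^*$, i.e. $\Omega(x+f)=\alpha(x)+f\circ\alpha$ for $x\in\mathfrak g$, $f\in\mathfrak g^*$, is an automorphism of the Lie algebra $T^*(\mathfrak g)$ that is symmetric with respect to $B_0$ if and only if $\mathrm{Im}(\alpha^2-\mathrm{id})\subseteq\mathcal Z(\mathfrak g)$, where $\mathcal Z(\mathfrak g)$ is the center of $\mathfrak g$. Hence, if $\mathrm{Im}(\alpha^2-\mathrm{id})\subseteq\mathcal Z(\mathfrak g)$, then $(T^*(\mathfrak g),[\cdot,\cdot]_\Omega,\Omega,B_\Omega)$ is a regular quadratic Hom-Lie algebra, where $[u,v]_\Omega=[\Omega(u),\Omega(v)]$ and $B_\Omega(u,v)=B_0(\Omega(u),v)$ for $u,v\in T^*(\mathfrak g)$.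
   Context: $\mathbb K$ is an algebraically closed field of characteristic $0$. For a Lie algebra $\mathfrak g$, $T^*(\mathfrak g)$ is the vector space $\mathfrak g\oplus\mathfrak g^*$ with the Lie bracket $[x+f,y+h]=[x,y]_{\mathfrak g}+f\circ\mathrm{ad}\,y-h\circ\mathrm{ad}\,x$ and the invariant symmetric nondegenerate form $B_0(x+f,y+h)=f(y)+h(x)$ ($x,y\in\mathfrak g$, $f,h\in\mathfrak g^*$). A linear map $\Omega$ is symmetric with respect to $B_0$ if $B_0(\Omega(u),v)=B_0(u,\Omega(v))$. A Hom-Lie algebra is a triple $(\mathfrak h,[\cdot,\cdot],\alpha)$ with $[\cdot,\cdot]$ a skew-symmetric bilinear bracket and $\alpha$ linear such that $[\alpha(x),[y,z]]+[\alpha(y),[z,x]]+[\alpha(z),[x,y]]=0$. A regular quadratic Hom-Lie algebra $(\mathfrak h,[\cdot,\cdot],\alpha,B)$ is a Hom-Lie algebra with $\alpha$ invertible and a symmetric nondegenerate bilinear form $B$ with $B([x,y],z)=B(x,[y,z])$ and $B(\alpha(x),y)=B(x,\alpha(y))$. *)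

theory Defs
  imports
    "HOL-Computational_Algebra.Polynomial"
    "HOL-Library.Function_Algebras"
    "HOL-Library.Product_Plus"
begin

text \<open>
  An algebra is a subspace \<open>V\<close> of an ambient vector space, given by its scalar
  multiplication, with operations that are only constrained on \<open>V\<close>. The carrier is needed
  because the dual space of a space \<open>'g\<close> is not a type but a subspace of
  \<open>'g \<Rightarrow> 'k\<close>. An abstract Lie algebra is the case \<open>V = UNIV\<close>. No space is assumed to be
  finite-dimensional.
\<close>

definition linear_on ::
    "('k \<Rightarrow> 'v \<Rightarrow> 'v) \<Rightarrow> ('k \<Rightarrow> 'w \<Rightarrow> 'w) \<Rightarrow> 'v set \<Rightarrow> ('v::plus \<Rightarrow> 'w::plus) \<Rightarrow> bool" where
  "linear_on s1 s2 V f \<longleftrightarrow>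
     (\<forall>x\<in>V. \<forall>y\<in>V. f (x + y) = f x + f y) \<and> (\<forall>c. \<forall>x\<in>V. f (s1 c x) = s2 c (f x))"

definition bilinear_on ::
    "('k \<Rightarrow> 'v \<Rightarrow> 'v) \<Rightarrow> ('k \<Rightarrow> 'w \<Rightarrow> 'w) \<Rightarrow> 'v set \<Rightarrow> ('v::plus \<Rightarrow> 'v \<Rightarrow> 'w::plus) \<Rightarrow> bool" where
  "bilinear_on s1 s2 V b \<longleftrightarrow>
     (\<forall>x\<in>V. linear_on s1 s2 V (b x)) \<and> (\<forall>y\<in>V. linear_on s1 s2 V (\<lambda>x. b x y))"

locale algebra_on = vector_space scale
  for scale :: "'k::field \<Rightarrow> 'v::ab_group_add \<Rightarrow> 'v" +
  fixes V :: "'v set" and br :: "'v \<Rightarrow> 'v \<Rightarrow> 'v"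
  assumes subspace_carrier: "subspace V"
    and bracket_closed: "x \<in> V \<Longrightarrow> y \<in> V \<Longrightarrow> br x y \<in> V"
    and bracket_bilinear: "bilinear_on scale scale V br"

locale lie_algebra_on = algebra_on scale V br
  for scale :: "'k::field \<Rightarrow> 'v::ab_group_add \<Rightarrow> 'v" and V br +
  assumes bracket_self: "x \<in> V \<Longrightarrow> br x x = 0"
    and jacobi: "x \<in> V \<Longrightarrow> y \<in> V \<Longrightarrow> z \<in> V \<Longrightarrow>
      br x (br y z) + br y (br z x) + br z (br x y) = 0"

locale lie_automorphism_on = lie_algebra_on scale V br
  for scale :: "'k::field \<Rightarrow> 'v::ab_group_add \<Rightarrow> 'v" and V br +
  fixes \<phi> :: "'v \<Rightarrow> 'v"
  assumes auto_linear: "linear_on scale scale V \<phi>"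
    and auto_bij: "bij_betw \<phi> V V"
    and auto_bracket: "x \<in> V \<Longrightarrow> y \<in> V \<Longrightarrow> \<phi> (br x y) = br (\<phi> x) (\<phi> y)"

definition lie_center :: "'v set \<Rightarrow> ('v \<Rightarrow> 'v \<Rightarrow> 'v::zero) \<Rightarrow> 'v set" where
  "lie_center V br = {x \<in> V. \<forall>y\<in>V. br x y = 0}"

definition symmetric_wrt :: "'v set \<Rightarrow> ('v \<Rightarrow> 'v \<Rightarrow> 'k) \<Rightarrow> ('v \<Rightarrow> 'v) \<Rightarrow> bool" where
  "symmetric_wrt V B \<phi> \<longleftrightarrow> (\<forall>u\<in>V. \<forall>v\<in>V. B (\<phi> u) v = B u (\<phi> v))"

locale hom_lie_algebra_on = algebra_on scale V br
  for scale :: "'k::field \<Rightarrow> 'v::ab_group_add \<Rightarrow> 'v" and V br +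
  fixes \<alpha> :: "'v \<Rightarrow> 'v"
  assumes skew_symmetric: "x \<in> V \<Longrightarrow> y \<in> V \<Longrightarrow> br x y = - br y x"
    and twist_closed: "x \<in> V \<Longrightarrow> \<alpha> x \<in> V"
    and twist_linear: "linear_on scale scale V \<alpha>"
    and hom_jacobi: "x \<in> V \<Longrightarrow> y \<in> V \<Longrightarrow> z \<in> V \<Longrightarrow>
      br (\<alpha> x) (br y z) + br (\<alpha> y) (br z x) + br (\<alpha> z) (br x y) = 0"

locale regular_quadratic_hom_lie_algebra_on = hom_lie_algebra_on scale V br \<alpha>
  for scale :: "'k::field \<Rightarrow> 'v::ab_group_add \<Rightarrow> 'v" and V br \<alpha> +
  fixes B :: "'v \<Rightarrow> 'v \<Rightarrow> 'k"
  assumes twist_bij: "bij_betw \<alpha> V V"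
    and form_bilinear: "bilinear_on scale (*) V B"
    and form_symmetric: "x \<in> V \<Longrightarrow> y \<in> V \<Longrightarrow> B x y = B y x"
    and form_nondegenerate: "x \<in> V \<Longrightarrow> (\<And>y. y \<in> V \<Longrightarrow> B x y = 0) \<Longrightarrow> x = 0"
    and form_invariant: "x \<in> V \<Longrightarrow> y \<in> V \<Longrightarrow> z \<in> V \<Longrightarrow> B (br x y) z = B x (br y z)"
    and twist_symmetric: "symmetric_wrt V B \<alpha>"

text \<open>
  For a Lie algebra on the whole type \<open>'g\<close>, the element \<open>x + f\<close> of \<open>T\<^sup>*(g)\<close> is the pair
  \<open>(x, f)\<close>, where \<open>f\<close> is an arbitrary linear functional; addition is the pointwise one.
\<close>

definition dual_space :: "('k \<Rightarrow> 'g \<Rightarrow> 'g) \<Rightarrow> ('g::ab_group_add \<Rightarrow> 'k::field) set" where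
  "dual_space scale = {f. Vector_Spaces.linear scale (*) f}"

definition T_star :: "('k \<Rightarrow> 'g \<Rightarrow> 'g) \<Rightarrow> ('g::ab_group_add \<times> ('g \<Rightarrow> 'k::field)) set" where
  "T_star scale = UNIV \<times> dual_space scale"

fun T_star_scale ::
    "('k \<Rightarrow> 'g \<Rightarrow> 'g) \<Rightarrow> 'k::times \<Rightarrow> 'g \<times> ('g \<Rightarrow> 'k) \<Rightarrow> 'g \<times> ('g \<Rightarrow> 'k)" where
  "T_star_scale scale c (x, f) = (scale c x, \<lambda>z. c * f z)"

text \<open>The partial application \<open>br y\<close> is the adjoint map of \<open>y\<close>.\<close>

fun T_star_bracket ::
    "('g \<Rightarrow> 'g \<Rightarrow> 'g) \<Rightarrow> 'g \<times> ('g \<Rightarrow> 'k::minus) \<Rightarrow> 'g \<times> ('g \<Rightarrow> 'k) \<Rightarrow> 'g \<times> ('g \<Rightarrow> 'k)" where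
  "T_star_bracket br (x, f) (y, h) = (br x y, (f \<circ> br y) - (h \<circ> br x))"

fun T_star_form :: "'g \<times> ('g \<Rightarrow> 'k::plus) \<Rightarrow> 'g \<times> ('g \<Rightarrow> 'k) \<Rightarrow> 'k" where
  "T_star_form (x, f) (y, h) = f y + h x"

fun T_star_map :: "('g \<Rightarrow> 'g) \<Rightarrow> 'g \<times> ('g \<Rightarrow> 'k) \<Rightarrow> 'g \<times> ('g \<Rightarrow> 'k)" where
  "T_star_map \<alpha> (x, f) = (\<alpha> x, f \<circ> \<alpha>)"

end

theory Submission
  imports Defs
begin

text \<open>
  Comparing dual components, \<open>\<Omega>\<close> preserves the bracket of \<open>T\<^sup>*(g)\<close> iff
  \<open>f [y, \<alpha> z] = f (\<alpha> [\<alpha> y, z]) = f [\<alpha>\<^sup>2 y, \<alpha> z]\<close> for all functionals \<open>f\<close>; since functionals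
  separate points and \<open>\<alpha>\<close> is onto, this says that \<open>\<alpha>\<^sup>2 y - y\<close> is central. Symmetry and
  bijectivity of \<open>\<Omega>\<close> are automatic. The second part is an instance of a general twist: a
  symmetric automorphism \<open>\<phi>\<close> of a quadratic Lie algebra turns it into a regular quadratic
  Hom-Lie algebra, the Hom-Jacobi identity being the Jacobi identity at \<open>\<phi>\<^sup>2 x, \<phi>\<^sup>2 y, \<phi>\<^sup>2 z\<close>.
\<close>

section \<open>Twisting a quadratic Lie algebra by a symmetric automorphism\<close>

lemma (in lie_algebra_on) bracket_skew:
  assumes "x \<in> V" "y \<in> V"
  shows "br x y = - br y x"
proof -
  have "x + y \<in> V"
    using assms subspace_carrier by (simp add: subspace_add)
  then have "0 = br (x + y) (x + y)"
    by (simp add: bracket_self)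
  also have "\<dots> = br x x + br x y + (br y x + br y y)"
    using assms bracket_bilinear \<open>x + y \<in> V\<close>
    by (simp add: bilinear_on_def linear_on_def)
  finally show ?thesis
    using assms by (simp add: bracket_self eq_neg_iff_add_eq_0)
qed

text \<open>For invariance, symmetry of \<open>\<phi>\<close> moves the outer \<open>\<phi>\<close>
  of \<open>B (\<phi> (br (\<phi> x) (\<phi> y))) z\<close> onto \<open>z\<close>, and invariance of
  \<open>B\<close> applies at \<open>\<phi> x\<close>, \<open>\<phi> y\<close>,
  \<open>\<phi> z\<close>. Nondegeneracy comes from that of \<open>B\<close> and injectivity of
  \<open>\<phi>\<close> on \<open>V\<close>.\<close>

theorem regular_quadratic_hom_lie_twist:
  assumes "lie_automorphism_on scale V br \<phi>"
    and bil: "bilinear_on scale (*) V B"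
    and sym: "\<And>x y. x \<in> V \<Longrightarrow> y \<in> V \<Longrightarrow> B x y = B y x"
    and nondeg: "\<And>x. x \<in> V \<Longrightarrow> (\<And>y. y \<in> V \<Longrightarrow> B x y = 0) \<Longrightarrow> x = 0"
    and inv: "\<And>x y z. x \<in> V \<Longrightarrow> y \<in> V \<Longrightarrow> z \<in> V \<Longrightarrow> B (br x y) z = B x (br y z)"
    and symw: "symmetric_wrt V B \<phi>"
  shows "regular_quadratic_hom_lie_algebra_on scale V (\<lambda>u v. br (\<phi> u) (\<phi> v)) \<phi> (\<lambda>u v. B (\<phi> u) v)"
proof -
  interpret lie_automorphism_on scale V br \<phi> by fact
  have closed: "\<phi> x \<in> V" if "x \<in> V" for x
    using auto_bij that by (auto simp: bij_betw_def)
  have add: "\<phi> (x + y) = \<phi> x + \<phi> y" and scl: "\<phi> (scale c x) = scale c (\<phi> x)"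
    if "x \<in> V" "y \<in> V" for x y c
    using auto_linear that by (auto simp: linear_on_def)
  have symB: "B (\<phi> x) y = B x (\<phi> y)" if "x \<in> V" "y \<in> V" for x y
    using symw that by (auto simp: symmetric_wrt_def)
  have zero: "x = 0" if "x \<in> V" "\<phi> x = 0" for x
  proof -
    have "0 \<in> V" using subspace_carrier by (simp add: subspace_0)
    moreover have "\<phi> 0 = 0" using scl[OF \<open>0 \<in> V\<close> \<open>0 \<in> V\<close>, of 0] by simp
    ultimately show ?thesis
      using auto_bij that by (metis bij_betw_def inj_onD)
  qed
  show ?thesis
  proof unfold_locales
    show "bilinear_on scale scale V (\<lambda>u v. br (\<phi> u) (\<phi> v))"
      using bracket_bilinear by (simp add: bilinear_on_def linear_on_def closed add scl)
    show "bilinear_on scale (*) V (\<lambda>u. B (\<phi> u))"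
      using bil by (simp add: bilinear_on_def linear_on_def closed add scl)
  next
    fix x y z assume V: "x \<in> V" "y \<in> V" "z \<in> V"
    show "br (\<phi> (\<phi> x)) (\<phi> (br (\<phi> y) (\<phi> z))) + br (\<phi> (\<phi> y)) (\<phi> (br (\<phi> z) (\<phi> x))) +
      br (\<phi> (\<phi> z)) (\<phi> (br (\<phi> x) (\<phi> y))) = 0"
      using V jacobi by (simp add: auto_bracket closed)
    show "B (\<phi> (br (\<phi> x) (\<phi> y))) z = B (\<phi> x) (br (\<phi> y) (\<phi> z))"
      using V by (simp add: symB bracket_closed closed inv)
  next
    fix x assume "x \<in> V" "\<And>y. y \<in> V \<Longrightarrow> B (\<phi> x) y = 0"
    then show "x = 0" using nondeg zero closed by blast
  next
    fix x y assume "x \<in> V" "y \<in> V"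
    then show "B (\<phi> x) y = B (\<phi> y) x"
      by (metis closed sym symB)
  next
    show "symmetric_wrt V (\<lambda>u. B (\<phi> u)) \<phi>"
      by (simp add: symmetric_wrt_def symB closed)
  qed (auto intro: subspace_carrier bracket_closed closed bracket_skew auto_linear auto_bij)
qed

section \<open>Linear functionals\<close>

lemma (in vector_space) dual_space_iff:
  "f \<in> dual_space scale \<longleftrightarrow> (\<forall>x y. f (x + y) = f x + f y) \<and> (\<forall>c x. f (scale c x) = c * f x)"
proof -
  interpret K: vector_space "(*) :: 'a \<Rightarrow> 'a \<Rightarrow> 'a"
    by unfold_locales (auto simp: algebra_simps)
  show ?thesis
    using vector_space_axioms K.vector_space_axioms
    by (auto simp: dual_space_def Vector_Spaces.linear_iff)
qed

text \<open>A nonzero \<open>x\<close> forms an independent set, so the value 1 at \<open>x\<close>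
  extends to a linear functional, in any dimension.\<close>

lemma (in vector_space) dual_space_separates:
  assumes "\<And>f. f \<in> dual_space scale \<Longrightarrow> f x = 0"
  shows "x = 0"
proof (rule ccontr)
  assume "x \<noteq> 0"
  interpret K: vector_space "(*) :: 'a \<Rightarrow> 'a \<Rightarrow> 'a"
    by unfold_locales (auto simp: algebra_simps)
  interpret vector_space_pair scale "(*)" ..
  have "independent {x}" using \<open>x \<noteq> 0\<close> by simp
  then obtain f where "Vector_Spaces.linear scale (*) f" "f x = 1"
    using linear_independent_extend[of "{x}" "\<lambda>_. 1"] by auto
  then show False
    using assms[of f] by (simp add: dual_space_def)
qed

section \<open>The Lie algebra structure on pairs\<close>

lemma T_star_vector_space:
  assumes "vector_space scale"
  shows "vector_space (T_star_scale scale)"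
proof -
  interpret vector_space scale by fact
  show ?thesis
    by unfold_locales
      (auto simp: algebra_simps fun_eq_iff scale_right_distrib scale_left_distrib)
qed

text \<open>This is the semidirect product of the Lie algebra with its dual as an abelian ideal,
  under the coadjoint action. The dual component of the Jacobi identity holds because the adjoint
  map is a representation, which is \<open>ad_ad\<close>.\<close>

lemma T_star_lie_algebra:
  fixes scale :: "'k::field \<Rightarrow> 'g::ab_group_add \<Rightarrow> 'g"
  assumes "lie_algebra_on scale UNIV br"
  shows "lie_algebra_on (T_star_scale scale) (T_star scale) (T_star_bracket br)"
proof -
  interpret lie_algebra_on scale UNIV br by fact
  interpret T: vector_space "T_star_scale scale"
    by (rule T_star_vector_space) unfold_locales
  have br_lin: "br (x + y) z = br x z + br y z" "br z (x + y) = br z x + br z y"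
    "br (scale c x) z = scale c (br x z)" "br z (scale c x) = scale c (br z x)" for x y z c
    using bracket_bilinear by (auto simp: bilinear_on_def linear_on_def)
  have ad_ad: "br (br x y) z = br x (br y z) - br y (br x z)" for x y z
  proof -
    \<comment> \<open>The scalar -1 in \<open>br_lin(4)\<close> pulls a sign out of the second
      argument.\<close>
    have "br y (br x z) = - br y (br z x)" "br (br x y) z = - br z (br x y)"
      using bracket_skew[of x z] bracket_skew[of "br x y" z] br_lin(4)[of y "-1" "br z x"]
      by simp_all
    moreover have "br x (br y z) = - (br y (br z x) + br z (br x y))"
      using jacobi[of x y z] by (simp only: eq_neg_iff_add_eq_0 add.assoc UNIV_I simp_thms)
    ultimately show ?thesis by simp
  qed
  show ?thesis
  proof unfold_locales
    show "T.subspace (T_star scale)"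
      unfolding T.subspace_def T_star_def
      by (auto simp: dual_space_iff zero_prod_def algebra_simps)
  next
    fix u v :: "'g \<times> ('g \<Rightarrow> 'k)" assume "u \<in> T_star scale" "v \<in> T_star scale"
    then show "T_star_bracket br u v \<in> T_star scale"
      by (cases u; cases v) (auto simp: T_star_def dual_space_iff br_lin algebra_simps)
  next
    show "bilinear_on (T_star_scale scale) (T_star_scale scale) (T_star scale) (T_star_bracket br)"
      unfolding bilinear_on_def linear_on_def T_star_def
      by (auto simp: dual_space_iff br_lin fun_eq_iff algebra_simps)
  next
    fix u :: "'g \<times> ('g \<Rightarrow> 'k)" assume "u \<in> T_star scale"
    then show "T_star_bracket br u u = 0"
      by (cases u) (auto simp: bracket_self zero_prod_def)
  next
    fix u v w :: "'g \<times> ('g \<Rightarrow> 'k)"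
    assume V: "u \<in> T_star scale" "v \<in> T_star scale" "w \<in> T_star scale"
    obtain x f y g z h where eq: "u = (x, f)" "v = (y, g)" "w = (z, h)"
      by (metis surj_pair)
    have "k (a - b) = k a - k b" if "k \<in> dual_space scale" for k a b
    proof -
      have "k (a - b) + k b = k a"
        using that by (metis diff_add_cancel dual_space_iff)
      then show ?thesis by (simp add: algebra_simps)
    qed
    \<comment> \<open>Once nested brackets are expanded under a functional, the terms in
      \<open>f\<close>, in \<open>g\<close> and in \<open>h\<close> cancel separately.\<close>
    then have dual_diff: "k (br (br a b) c) = k (br a (br b c)) - k (br b (br a c))"
      if "k \<in> dual_space scale" for k a b c
      using that by (simp add: ad_ad)
    have "f \<in> dual_space scale" "g \<in> dual_space scale" "h \<in> dual_space scale"
      using V by (auto simp: eq T_star_def)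
    then show "T_star_bracket br u (T_star_bracket br v w) +
        T_star_bracket br v (T_star_bracket br w u) + T_star_bracket br w (T_star_bracket br u v) = 0"
      using jacobi[of x y z] by (auto simp: eq zero_prod_def fun_eq_iff dual_diff)
  qed
qed

section \<open>The canonical form\<close>

lemma T_star_form_bilinear:
  "bilinear_on (T_star_scale scale) (*) (T_star scale) T_star_form"
  if "vector_space scale"
  using vector_space.dual_space_iff[OF that]
  by (auto simp: bilinear_on_def linear_on_def T_star_def algebra_simps)

lemma T_star_form_symmetric: "T_star_form u v = T_star_form v (u :: _ \<times> (_ \<Rightarrow> _ :: ab_semigroup_add))"
  by (cases u; cases v) (simp add: add.commute)

text \<open>Pairing with \<open>(y, 0)\<close> gives \<open>f = 0\<close>; pairing with
  \<open>(0, g)\<close> then leaves \<open>g x = 0\<close> for every functional \<open>g\<close>,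
  and functionals separate points.\<close>

lemma T_star_form_nondegenerate:
  assumes "vector_space scale" "\<And>v. v \<in> T_star scale \<Longrightarrow> T_star_form u v = 0"
  shows "u = 0"
proof -
  interpret vector_space scale by fact
  obtain x f where u: "u = (x, f)" by (cases u)
  have "f y = 0" for y
    using assms(2)[of "(y, 0)"] by (simp add: u T_star_def dual_space_iff)
  moreover have "x = 0"
  proof (rule dual_space_separates)
    fix g assume "g \<in> dual_space scale"
    then show "g x = 0"
      using assms(2)[of "(0, g)"] \<open>\<And>y. f y = 0\<close> by (simp add: u T_star_def)
  qed
  ultimately show ?thesis by (auto simp: u zero_prod_def)
qed

text \<open>Both sides amount to \<open>f [y, z] + g [z, x] + h [x, y]\<close>; the terms in
  \<open>g\<close> and \<open>h\<close> appear with swapped brackets, which skew-symmetry under a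
  functional repairs.\<close>

lemma T_star_form_invariant:
  assumes "lie_algebra_on scale UNIV br" "v \<in> T_star scale" "w \<in> T_star scale"
  shows "T_star_form (T_star_bracket br u v) w = T_star_form u (T_star_bracket br v w)"
proof -
  interpret lie_algebra_on scale UNIV br by fact
  obtain x f y g z h where eq: "u = (x, f)" "v = (y, g)" "w = (z, h)"
    by (metis surj_pair)
  have dual_skew: "k (br a b) = - k (br b a)" if "k \<in> dual_space scale" for k a b
  proof -
    \<comment> \<open>The deleted rule would turn the scalar -1 into a negation before homogeneity
      of \<open>k\<close> could be applied.\<close>
    have "k (scale (-1) (br b a)) = - k (br b a)"
      using that by (simp add: dual_space_iff del: scale_minus_left)
    then show ?thesis
      using bracket_skew[of a b] by simp
  qed
  have "g \<in> dual_space scale" "h \<in> dual_space scale"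
    using assms(2,3) by (auto simp: eq T_star_def)
  then show ?thesis
    using dual_skew[of g x z] dual_skew[of h x y] by (simp add: eq)
qed

section \<open>The induced map on pairs\<close>

lemma T_star_map_symmetric: "symmetric_wrt (T_star scale) T_star_form (T_star_map \<alpha>)"
  by (auto simp: symmetric_wrt_def)

text \<open>The inverse is the same construction applied to \<open>inv \<alpha>\<close>.\<close>

lemma T_star_map_bij_betw:
  assumes "lie_automorphism_on scale UNIV br \<alpha>"
  shows "bij_betw (T_star_map \<alpha>) (T_star scale) (T_star scale)"
proof -
  interpret lie_automorphism_on scale UNIV br \<alpha> by fact
  have lin: "\<alpha> (x + y) = \<alpha> x + \<alpha> y" "\<alpha> (scale c x) = scale c (\<alpha> x)" for x y c
    using auto_linear by (auto simp: linear_on_def)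
  have i: "inv \<alpha> (\<alpha> x) = x" "\<alpha> (inv \<alpha> x) = x" for x
    using auto_bij by (simp_all add: bij_is_inj bij_is_surj surj_f_inv_f)
  \<comment> \<open>Linearity of the inverse ensures that \<open>f \<circ> inv \<alpha>\<close> is
    again a functional.\<close>
  have inv_lin: "inv \<alpha> (x + y) = inv \<alpha> x + inv \<alpha> y" "inv \<alpha> (scale c x) = scale c (inv \<alpha> x)" for x y c
    by (metis i lin)+
  show ?thesis
    by (rule bij_betw_byWitness[where f' = "T_star_map (inv \<alpha>)"])
      (auto simp: T_star_def dual_space_iff fun_eq_iff i lin inv_lin)
qed

lemma T_star_map_automorphism_iff:
  fixes br :: "'g::ab_group_add \<Rightarrow> 'g \<Rightarrow> 'g" and scale :: "'k::field \<Rightarrow> 'g \<Rightarrow> 'g"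
  assumes "lie_automorphism_on scale UNIV br \<alpha>"
  shows "lie_automorphism_on (T_star_scale scale) (T_star scale) (T_star_bracket br) (T_star_map \<alpha>)
    \<longleftrightarrow> range (\<lambda>x. (\<alpha> ^^ 2) x - x) \<subseteq> lie_center UNIV br"
proof -
  interpret lie_automorphism_on scale UNIV br \<alpha> by fact
  interpret T: lie_algebra_on "T_star_scale scale" "T_star scale" "T_star_bracket br"
    by (rule T_star_lie_algebra) unfold_locales
  have auto: "\<alpha> (br x y) = br (\<alpha> x) (\<alpha> y)" for x y
    by (simp add: auto_bracket)
  have br_diff: "br (x - y) z = br x z - br y z" for x y z
  proof -
    have "br (x - y) z + br y z = br (x - y + y) z"
      using bracket_bilinear unfolding bilinear_on_def linear_on_def by (metis UNIV_I)
    then show ?thesis by (simp add: algebra_simps)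
  qed
  have central: "range (\<lambda>x. (\<alpha> ^^ 2) x - x) \<subseteq> lie_center UNIV br
      \<longleftrightarrow> (\<forall>y z. br (\<alpha> (\<alpha> y)) z = br y z)"
    by (simp add: lie_center_def image_subset_iff br_diff numeral_2_eq_2)
  have "T_star_map \<alpha> (T_star_bracket br u v) = T_star_bracket br (T_star_map \<alpha> u) (T_star_map \<alpha> v)"
    if "\<forall>y z. br (\<alpha> (\<alpha> y)) z = br y z" for u v :: "'g \<times> ('g \<Rightarrow> 'k)"
    using that by (cases u; cases v) (simp add: fun_eq_iff auto)
  moreover have "linear_on (T_star_scale scale) (T_star_scale scale) (T_star scale) (T_star_map \<alpha>)"
    using auto_linear by (auto simp: linear_on_def T_star_def)
  moreover have "br (\<alpha> (\<alpha> y)) z = br y z"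
    if hom: "\<And>u v. u \<in> T_star scale \<Longrightarrow> v \<in> T_star scale \<Longrightarrow>
        T_star_map \<alpha> (T_star_bracket br u v) = T_star_bracket br (T_star_map \<alpha> u) (T_star_map \<alpha> v)"
    for y z
  proof -
    \<comment> \<open>The dual components will be compared at \<open>w\<close>, where the last
      bracket argument becomes \<open>\<alpha> w\<close>, that is, \<open>z\<close>.\<close>
    obtain w where w: "z = \<alpha> w"
      using auto_bij by (metis bij_pointE)
    have "br y z - br (\<alpha> (\<alpha> y)) z = 0"
    proof (rule dual_space_separates)
      fix f assume f: "f \<in> dual_space scale"
      then have "f (a - b) + f b = f a" for a b
        by (metis diff_add_cancel dual_space_iff)
      \<comment> \<open>A pure functional against a pure vector isolates the single term
        \<open>f \<circ> br y\<close> in the dual component.\<close>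
      moreover have "T_star_map \<alpha> (T_star_bracket br (0, f) (y, 0)) =
          T_star_bracket br (T_star_map \<alpha> (0, f)) (T_star_map \<alpha> (y, 0))"
        using f by (intro hom) (auto simp: T_star_def dual_space_iff)
      then have "f (br y (\<alpha> w)) = f (br (\<alpha> (\<alpha> y)) (\<alpha> w))"
        by (simp add: fun_eq_iff auto)
      ultimately show "f (br y z - br (\<alpha> (\<alpha> y)) z) = 0"
        by (metis w add_cancel_left_left)
    qed
    then show ?thesis by simp
  qed
  ultimately show ?thesis
    unfolding central lie_automorphism_on_def lie_automorphism_on_axioms_def
    using T.lie_algebra_on_axioms T_star_map_bij_betw[OF assms] by blast
qed

theorem theorem4p4:
  fixes scale :: "'k::{alg_closed_field, field_char_0} \<Rightarrow> 'g::ab_group_add \<Rightarrow> 'g"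
    and br :: "'g \<Rightarrow> 'g \<Rightarrow> 'g"
    and \<alpha> :: "'g \<Rightarrow> 'g"
  assumes "lie_algebra_on scale UNIV br"
    and "lie_automorphism_on scale UNIV br \<alpha>"
  shows "((lie_automorphism_on (T_star_scale scale) (T_star scale) (T_star_bracket br) (T_star_map \<alpha>)
           \<and> symmetric_wrt (T_star scale) T_star_form (T_star_map \<alpha> :: 'g \<times> ('g \<Rightarrow> 'k) \<Rightarrow> _))
          \<longleftrightarrow> range (\<lambda>x. (\<alpha> ^^ 2) x - x) \<subseteq> lie_center UNIV br)
    \<and> (range (\<lambda>x. (\<alpha> ^^ 2) x - x) \<subseteq> lie_center UNIV br \<longrightarrow>
         regular_quadratic_hom_lie_algebra_on (T_star_scale scale) (T_star scale)
           (\<lambda>u v. T_star_bracket br (T_star_map \<alpha> u) (T_star_map \<alpha> v))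
           (T_star_map \<alpha>)
           (\<lambda>u v. T_star_form (T_star_map \<alpha> u) v))"
proof -
  have vs: "vector_space scale"
    using assms(1) by (simp add: lie_algebra_on_def algebra_on_def)
  note aut_iff = T_star_map_automorphism_iff[OF assms(2)]
  show ?thesis
  proof (intro conjI impI)
    show "(lie_automorphism_on (T_star_scale scale) (T_star scale) (T_star_bracket br) (T_star_map \<alpha>)
           \<and> symmetric_wrt (T_star scale) T_star_form (T_star_map \<alpha> :: 'g \<times> ('g \<Rightarrow> 'k) \<Rightarrow> _))
          \<longleftrightarrow> range (\<lambda>x. (\<alpha> ^^ 2) x - x) \<subseteq> lie_center UNIV br"
      by (simp add: aut_iff T_star_map_symmetric)
  next
    assume "range (\<lambda>x. (\<alpha> ^^ 2) x - x) \<subseteq> lie_center UNIV br"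
    \<comment> \<open>The twist is applied to the induced map and the canonical form; the centrality
      hypothesis enters through \<open>aut_iff\<close>, as the automorphism property.\<close>
    then show "regular_quadratic_hom_lie_algebra_on (T_star_scale scale) (T_star scale)
           (\<lambda>u v. T_star_bracket br (T_star_map \<alpha> u) (T_star_map \<alpha> v))
           (T_star_map \<alpha>)
           (\<lambda>u v. T_star_form (T_star_map \<alpha> u) v)"
      using aut_iff
      by (intro regular_quadratic_hom_lie_twist T_star_form_bilinear[OF vs] T_star_form_symmetric
          T_star_form_invariant[OF assms(1)] T_star_map_symmetric)
        (auto intro: T_star_form_nondegenerate[OF vs])
  qed
qed

end
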